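(* Let $T$ be a truss, $M$ a left $T$-module and $e\in M$. The truss $T[M;e]$ is ring-type if and only if $M=\{e\}$ and $T=\mathrm{T}(R)$ for some ring $R$.
   Context: A heap is a set $H$ with a ternary operation $[-,-,-]$ such that $[[a,b,c],d,e]=[a,b,[c,d,e]]$ and $[b,b,a]=a=[a,b,b]$; it is abelian if $[a,b,c]=[c,b,a]$. A truss is an abelian heap $T$ with an associative binary multiplication such that $a[b,c,d]=[ab,ac,ad]$ and $[b,c,d]a=[ba,ca,da]$. A left $T$-module is an abelian heap $M$ with an action $(t,m)\mapsto t\cdot m$ such that $t\cdot(t'\cdot m)=(tt')\cdot m$, $[t,t',t'']\cdot m=[t\cdot m,t'\cdot m,t''\cdot m]$ and $t\cdot[m,m',m'']=[t\cdot m,t\cdot m',t\cdot m'']$. For $e\in M$, $T[M;e]$ is the truss on $T\times M$ with the componentwise heap operation and multiplication $(t,m)(t',m')=(tt',[m,t\cdot e,t\cdot m'])$. A truss is ring-type if it has an absorber, i.e. an element $0$ with $0t=t0=0$ for all $t$. For a ring $R$ (associative, not necessarily with identity), $\mathrm{T}(R)$ is the truss on the set $R$ with $[a,b,c]=a-b+c$ and the multiplication of $R$. *)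

theory Defs
  imports "HOL-Algebra.Ring"
begin

text \<open>Structures are records with an explicit carrier, which may be empty; the values of the
  operations outside the carrier are irrelevant.\<close>

record 'a heap = "'a partial_object" +
  bracket :: "'a \<Rightarrow> 'a \<Rightarrow> 'a \<Rightarrow> 'a" ("\<langle>_, _, _\<rangle>\<index>")

record 'a truss = "'a heap" +
  tmult :: "'a \<Rightarrow> 'a \<Rightarrow> 'a" (infixl "\<cdot>\<index>" 70)

locale heap =
  fixes H (structure)
  assumes bracket_closed:
      "\<lbrakk>a \<in> carrier H; b \<in> carrier H; c \<in> carrier H\<rbrakk> \<Longrightarrow> \<langle>a, b, c\<rangle> \<in> carrier H"
    and bracket_assoc:
      "\<lbrakk>a \<in> carrier H; b \<in> carrier H; c \<in> carrier H; d \<in> carrier H; e \<in> carrier H\<rbrakk>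
       \<Longrightarrow> \<langle>\<langle>a, b, c\<rangle>, d, e\<rangle> = \<langle>a, b, \<langle>c, d, e\<rangle>\<rangle>"
    and bracket_cancel_left:
      "\<lbrakk>a \<in> carrier H; b \<in> carrier H\<rbrakk> \<Longrightarrow> \<langle>b, b, a\<rangle> = a"
    and bracket_cancel_right:
      "\<lbrakk>a \<in> carrier H; b \<in> carrier H\<rbrakk> \<Longrightarrow> \<langle>a, b, b\<rangle> = a"

locale abelian_heap = heap +
  assumes bracket_comm:
      "\<lbrakk>a \<in> carrier H; b \<in> carrier H; c \<in> carrier H\<rbrakk> \<Longrightarrow> \<langle>a, b, c\<rangle> = \<langle>c, b, a\<rangle>"

locale truss = abelian_heap T for T (structure) +
  assumes tmult_closed:
      "\<lbrakk>a \<in> carrier T; b \<in> carrier T\<rbrakk> \<Longrightarrow> a \<cdot> b \<in> carrier T"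
    and tmult_assoc:
      "\<lbrakk>a \<in> carrier T; b \<in> carrier T; c \<in> carrier T\<rbrakk> \<Longrightarrow> (a \<cdot> b) \<cdot> c = a \<cdot> (b \<cdot> c)"
    and tmult_bracket_left:
      "\<lbrakk>a \<in> carrier T; b \<in> carrier T; c \<in> carrier T; d \<in> carrier T\<rbrakk>
       \<Longrightarrow> a \<cdot> \<langle>b, c, d\<rangle> = \<langle>a \<cdot> b, a \<cdot> c, a \<cdot> d\<rangle>"
    and tmult_bracket_right:
      "\<lbrakk>a \<in> carrier T; b \<in> carrier T; c \<in> carrier T; d \<in> carrier T\<rbrakk>
       \<Longrightarrow> \<langle>b, c, d\<rangle> \<cdot> a = \<langle>b \<cdot> a, c \<cdot> a, d \<cdot> a\<rangle>"

locale truss_module = T: truss T + M: abelian_heap M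
  for T (structure) and M (structure) and act :: "'t \<Rightarrow> 'm \<Rightarrow> 'm" +
  constrains T :: "('t, 'p) truss_scheme" and M :: "('m, 'q) heap_scheme"
  assumes act_closed:
      "\<lbrakk>t \<in> carrier T; m \<in> carrier M\<rbrakk> \<Longrightarrow> act t m \<in> carrier M"
    and act_act:
      "\<lbrakk>t \<in> carrier T; t' \<in> carrier T; m \<in> carrier M\<rbrakk>
       \<Longrightarrow> act t (act t' m) = act (t \<cdot>\<^bsub>T\<^esub> t') m"
    and act_bracket_left:
      "\<lbrakk>t \<in> carrier T; t' \<in> carrier T; t'' \<in> carrier T; m \<in> carrier M\<rbrakk>
       \<Longrightarrow> act \<langle>t, t', t''\<rangle>\<^bsub>T\<^esub> m = \<langle>act t m, act t' m, act t'' m\<rangle>\<^bsub>M\<^esub>"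
    and act_bracket_right:
      "\<lbrakk>t \<in> carrier T; m \<in> carrier M; m' \<in> carrier M; m'' \<in> carrier M\<rbrakk>
       \<Longrightarrow> act t \<langle>m, m', m''\<rangle>\<^bsub>M\<^esub> = \<langle>act t m, act t m', act t m''\<rangle>\<^bsub>M\<^esub>"

text \<open>The extension $T[M;e]$ of a truss by a module with a chosen element.\<close>

definition ext_truss ::
  "('t, 'p) truss_scheme \<Rightarrow> ('m, 'q) heap_scheme \<Rightarrow> ('t \<Rightarrow> 'm \<Rightarrow> 'm) \<Rightarrow> 'm \<Rightarrow> ('t \<times> 'm) truss"
  where "ext_truss T M act e =
    \<lparr> carrier = carrier T \<times> carrier M,
      bracket = (\<lambda>(t, m) (t', m') (t'', m''). (\<langle>t, t', t''\<rangle>\<^bsub>T\<^esub>, \<langle>m, m', m''\<rangle>\<^bsub>M\<^esub>)),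
      tmult = (\<lambda>(t, m) (t', m'). (t \<cdot>\<^bsub>T\<^esub> t', \<langle>m, act t e, act t m'\<rangle>\<^bsub>M\<^esub>)) \<rparr>"

definition absorber :: "('a, 'p) truss_scheme \<Rightarrow> 'a \<Rightarrow> bool"
  where "absorber T z \<longleftrightarrow>
    z \<in> carrier T \<and> (\<forall>t\<in>carrier T. z \<cdot>\<^bsub>T\<^esub> t = z \<and> t \<cdot>\<^bsub>T\<^esub> z = z)"

definition ring_type :: "('a, 'p) truss_scheme \<Rightarrow> bool"
  where "ring_type T \<longleftrightarrow> truss T \<and> (\<exists>z. absorber T z)"

text \<open>Associative rings, not necessarily with identity; the field \<open>one\<close> of the
  record is unconstrained.\<close>

locale nonunital_ring = abelian_group R for R (structure) +
  assumes mult_closed: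
      "\<lbrakk>x \<in> carrier R; y \<in> carrier R\<rbrakk> \<Longrightarrow> x \<otimes> y \<in> carrier R"
    and mult_assoc:
      "\<lbrakk>x \<in> carrier R; y \<in> carrier R; z \<in> carrier R\<rbrakk> \<Longrightarrow> (x \<otimes> y) \<otimes> z = x \<otimes> (y \<otimes> z)"
    and left_distr:
      "\<lbrakk>x \<in> carrier R; y \<in> carrier R; z \<in> carrier R\<rbrakk>
       \<Longrightarrow> (x \<oplus> y) \<otimes> z = x \<otimes> z \<oplus> y \<otimes> z"
    and right_distr:
      "\<lbrakk>x \<in> carrier R; y \<in> carrier R; z \<in> carrier R\<rbrakk>
       \<Longrightarrow> z \<otimes> (x \<oplus> y) = z \<otimes> x \<oplus> z \<otimes> y"

definition truss_of_ring :: "('a, 'p) ring_scheme \<Rightarrow> 'a truss"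
  where "truss_of_ring R =
    \<lparr> carrier = carrier R,
      bracket = (\<lambda>a b c. (a \<ominus>\<^bsub>R\<^esub> b) \<oplus>\<^bsub>R\<^esub> c),
      tmult = (\<lambda>a b. a \<otimes>\<^bsub>R\<^esub> b) \<rparr>"

text \<open>Equality of trusses. Equality of records would also compare the operations on arguments
  outside the carrier.\<close>

definition same_truss :: "('a, 'p) truss_scheme \<Rightarrow> ('a, 'q) truss_scheme \<Rightarrow> bool"
  where "same_truss S T \<longleftrightarrow>
    carrier S = carrier T \<and>
    (\<forall>a\<in>carrier S. \<forall>b\<in>carrier S. \<forall>c\<in>carrier S. \<langle>a, b, c\<rangle>\<^bsub>S\<^esub> = \<langle>a, b, c\<rangle>\<^bsub>T\<^esub>) \<and>
    (\<forall>a\<in>carrier S. \<forall>b\<in>carrier S. a \<cdot>\<^bsub>S\<^esub> b = a \<cdot>\<^bsub>T\<^esub> b)"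

end

theory Submission
  imports Defs
begin

text \<open>If \<open>(z, u)\<close> is an absorber of \<open>T[M;e]\<close>, then \<open>(z, u)(z, u) = (z, u)\<close> gives
  \<open>[u, z e, z u] = u\<close>, hence \<open>z u = z e\<close>. Then \<open>(z, m)(z, u)\<close> has second component
  \<open>[m, z e, z u] = m\<close> but must be \<open>(z, u)\<close>, so every \<open>m\<close> equals \<open>u\<close>.
  The first component \<open>z\<close> is an absorber of \<open>T\<close>, and \<open>a + b = [a, z, b]\<close> turns \<open>T\<close> into a ring.\<close>

definition retract_ring :: "('a, 'p) heap_scheme \<Rightarrow> ('a \<Rightarrow> 'a \<Rightarrow> 'a) \<Rightarrow> 'a \<Rightarrow> 'a ring"
  where "retract_ring H f z =
    \<lparr> carrier = carrier H, mult = f, one = z, zero = z, add = (\<lambda>a b. \<langle>a, z, b\<rangle>\<^bsub>H\<^esub>) \<rparr>"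

lemma retract_ring_simps [simp]:
  "carrier (retract_ring H f z) = carrier H"
  "x \<otimes>\<^bsub>retract_ring H f z\<^esub> y = f x y"
  "\<zero>\<^bsub>retract_ring H f z\<^esub> = z"
  "x \<oplus>\<^bsub>retract_ring H f z\<^esub> y = \<langle>x, z, y\<rangle>\<^bsub>H\<^esub>"
  by (simp_all add: retract_ring_def)

context abelian_heap
begin

lemma abelian_group_retract:
  assumes z: "z \<in> carrier H"
  shows "abelian_group (retract_ring H f z)"
proof (rule abelian_groupI)
  fix x
  assume "x \<in> carrier (retract_ring H f z)"
  \<comment> \<open>The additive inverse of \<open>x\<close> is [z, x, z]: associativity turns
    [[z, x, z], z, x] into [z, x, [z, z, x]] = [z, x, x] = z.\<close>
  then show "\<exists>y\<in>carrier (retract_ring H f z).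
      y \<oplus>\<^bsub>retract_ring H f z\<^esub> x = \<zero>\<^bsub>retract_ring H f z\<^esub>"
    using z by (intro bexI[of _ "\<langle>z, x, z\<rangle>"])
      (simp_all add: bracket_closed bracket_assoc bracket_cancel_left bracket_cancel_right)
qed (use z in \<open>auto simp: bracket_closed bracket_assoc bracket_cancel_left intro: bracket_comm\<close>)

text \<open>Every base point recovers the whole heap operation: the difference a - b is [a, b, z],
  and adding c cancels the remaining z.\<close>

lemma bracket_eq_retract:
  assumes z: "z \<in> carrier H" and a: "a \<in> carrier H" and b: "b \<in> carrier H"
    and c: "c \<in> carrier H"
  shows "\<langle>a, b, c\<rangle> = (a \<ominus>\<^bsub>retract_ring H f z\<^esub> b) \<oplus>\<^bsub>retract_ring H f z\<^esub> c"
proof -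
  interpret G: abelian_group "retract_ring H f z"
    using z by (rule abelian_group_retract)
  have "\<ominus>\<^bsub>retract_ring H f z\<^esub> b = \<langle>z, b, z\<rangle>"
    by (rule G.minus_equality)
      (use z b in \<open>simp_all add: bracket_closed bracket_assoc bracket_cancel_left
        bracket_cancel_right\<close>)
  then have "(a \<ominus>\<^bsub>retract_ring H f z\<^esub> b) \<oplus>\<^bsub>retract_ring H f z\<^esub> c
      = \<langle>\<langle>a, z, \<langle>z, b, z\<rangle>\<rangle>, z, c\<rangle>"
    by (simp add: a_minus_def)
  \<comment> \<open>Reassociated as [[a, z, z], b, z], the inner bracket cancels to
    \<open>a\<close>.\<close>
  also have "\<dots> = \<langle>\<langle>a, b, z\<rangle>, z, c\<rangle>"
    using z a b by (simp add: bracket_closed bracket_cancel_right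
        flip: bracket_assoc[of a z z b z])
  also have "\<dots> = \<langle>a, b, c\<rangle>"
    using z a b c by (simp add: bracket_assoc bracket_cancel_left)
  finally show ?thesis ..
qed

text \<open>In a retract both sides are the same signed sum of nine elements, because the sign
  pattern of the 3 by 3 array is symmetric under transposition. This yields both distributive laws
  of T[M;e].\<close>

lemma bracket_medial:
  assumes a: "a \<in> carrier H" "a' \<in> carrier H" "a'' \<in> carrier H"
    and b: "b \<in> carrier H" "b' \<in> carrier H" "b'' \<in> carrier H"
    and c: "c \<in> carrier H" "c' \<in> carrier H" "c'' \<in> carrier H"
  shows "\<langle>\<langle>a, a', a''\<rangle>, \<langle>b, b', b''\<rangle>, \<langle>c, c', c''\<rangle>\<rangle> =
    \<langle>\<langle>a, b, c\<rangle>, \<langle>a', b', c'\<rangle>, \<langle>a'', b'', c''\<rangle>\<rangle>"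
proof -
  \<comment> \<open>Any base point would do, and the first projection merely fills the
    multiplication slot, since only the additive group is used.\<close>
  define G where "G = retract_ring H (\<lambda>x y. x) a"
  interpret G: abelian_group G
    unfolding G_def using a(1) by (rule abelian_group_retract)
  have carr: "carrier G = carrier H"
    by (simp add: G_def)
  have br: "\<langle>x, y, w\<rangle> = (x \<ominus>\<^bsub>G\<^esub> y) \<oplus>\<^bsub>G\<^esub> w"
    if "x \<in> carrier G" "y \<in> carrier G" "w \<in> carrier G" for x y w
    using that a(1) bracket_eq_retract unfolding G_def by simp
  show ?thesis
    using assms unfolding carr[symmetric]
    by (simp add: br a_minus_def G.minus_add G.a_ac)
qed

end

text \<open>Distributivity is where absorption enters: x(y + w) = [xy, xz, xw], and xz = z makes
  this xy + xw; symmetrically on the other side.\<close>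

lemma (in truss) nonunital_ring_retract:
  assumes "absorber T z"
  shows "nonunital_ring (retract_ring T (\<cdot>) z)"
proof -
  have z: "z \<in> carrier T"
    using assms by (simp add: absorber_def)
  interpret G: abelian_group "retract_ring T (\<cdot>) z"
    using z by (rule abelian_group_retract)
  show ?thesis
    by unfold_locales
      (use assms in \<open>auto simp: absorber_def tmult_closed tmult_assoc tmult_bracket_left
        tmult_bracket_right\<close>)
qed

lemma (in truss) same_truss_retract:
  assumes "z \<in> carrier T"
  shows "same_truss T (truss_of_ring (retract_ring T (\<cdot>) z))"
  using assms bracket_eq_retract by (simp add: same_truss_def truss_of_ring_def)

text \<open>Expanding (0 + 0)x and x(0 + 0) and cancelling in the additive group shows that zero
  absorbs.\<close>

lemma absorber_of_ring:
  assumes R: "nonunital_ring R" and S: "same_truss T (truss_of_ring R)"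
  shows "absorber T \<zero>\<^bsub>R\<^esub>"
proof -
  interpret nonunital_ring R by (rule R)
  have "\<zero>\<^bsub>R\<^esub> \<otimes>\<^bsub>R\<^esub> x = \<zero>\<^bsub>R\<^esub>" "x \<otimes>\<^bsub>R\<^esub> \<zero>\<^bsub>R\<^esub> = \<zero>\<^bsub>R\<^esub>" if x: "x \<in> carrier R" for x
    using left_distr[of "\<zero>\<^bsub>R\<^esub>" "\<zero>\<^bsub>R\<^esub>" x] right_distr[of "\<zero>\<^bsub>R\<^esub>" "\<zero>\<^bsub>R\<^esub>" x] x
    by (simp_all add: mult_closed)
  then show ?thesis
    using S by (simp add: absorber_def same_truss_def truss_of_ring_def)
qed

lemma ext_truss_simps [simp]:
  "carrier (ext_truss T M act e) = carrier T \<times> carrier M"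
  "\<langle>(t, m), (t', m'), (t'', m'')\<rangle>\<^bsub>ext_truss T M act e\<^esub> =
    (\<langle>t, t', t''\<rangle>\<^bsub>T\<^esub>, \<langle>m, m', m''\<rangle>\<^bsub>M\<^esub>)"
  "(t, m) \<cdot>\<^bsub>ext_truss T M act e\<^esub> (t', m') = (t \<cdot>\<^bsub>T\<^esub> t', \<langle>m, act t e, act t m'\<rangle>\<^bsub>M\<^esub>)"
  by (simp_all add: ext_truss_def)

context truss_module
begin

text \<open>This is the module component of left distributivity. The medial law regroups the
  right-hand side, where [m, m, m] = m and the three copies of \<open>act t e\<close> collapse
  likewise.\<close>

lemma act_bracket_affine:
  assumes "t \<in> carrier T" "e \<in> carrier M" "m \<in> carrier M"
    "x \<in> carrier M" "y \<in> carrier M" "w \<in> carrier M"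
  shows "\<langle>m, act t e, act t \<langle>x, y, w\<rangle>\<^bsub>M\<^esub>\<rangle>\<^bsub>M\<^esub> =
    \<langle>\<langle>m, act t e, act t x\<rangle>\<^bsub>M\<^esub>, \<langle>m, act t e, act t y\<rangle>\<^bsub>M\<^esub>, \<langle>m, act t e, act t w\<rangle>\<^bsub>M\<^esub>\<rangle>\<^bsub>M\<^esub>"
  using assms
  by (simp add: M.bracket_medial act_closed act_bracket_right M.bracket_cancel_left)

lemma truss_ext_truss:
  assumes e: "e \<in> carrier M"
  shows "truss (ext_truss T M act e)"
proof -
  \<comment> \<open>Module component of associativity of the product: distribute
    \<open>act t\<close> over the inner bracket, then reassociate.\<close>
  have assoc: "\<langle>\<langle>m, act t e, act t m'\<rangle>\<^bsub>M\<^esub>, act (t \<cdot>\<^bsub>T\<^esub> t') e, act (t \<cdot>\<^bsub>T\<^esub> t') m''\<rangle>\<^bsub>M\<^esub> =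
      \<langle>m, act t e, act t \<langle>m', act t' e, act t' m''\<rangle>\<^bsub>M\<^esub>\<rangle>\<^bsub>M\<^esub>"
    if "t \<in> carrier T" "t' \<in> carrier T" "m \<in> carrier M" "m' \<in> carrier M" "m'' \<in> carrier M"
    for t t' m m' m''
    using that e
    by (simp add: M.bracket_assoc T.tmult_closed act_closed act_bracket_right act_act)
  \<comment> \<open>Module component of right distributivity, again an instance of the medial
    law.\<close>
  have right: "\<langle>\<langle>x, y, w\<rangle>\<^bsub>M\<^esub>, act \<langle>t, t', t''\<rangle>\<^bsub>T\<^esub> e, act \<langle>t, t', t''\<rangle>\<^bsub>T\<^esub> m\<rangle>\<^bsub>M\<^esub> =
      \<langle>\<langle>x, act t e, act t m\<rangle>\<^bsub>M\<^esub>, \<langle>y, act t' e, act t' m\<rangle>\<^bsub>M\<^esub>, \<langle>w, act t'' e, act t'' m\<rangle>\<^bsub>M\<^esub>\<rangle>\<^bsub>M\<^esub>"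
    if "t \<in> carrier T" "t' \<in> carrier T" "t'' \<in> carrier T"
      "x \<in> carrier M" "y \<in> carrier M" "w \<in> carrier M" "m \<in> carrier M" for t t' t'' x y w m
    using that e by (simp only: act_bracket_left M.bracket_medial act_closed)
  show ?thesis
    by unfold_locales
      (use e in \<open>auto simp: T.bracket_closed T.bracket_assoc T.bracket_cancel_left
        T.bracket_cancel_right T.tmult_closed T.tmult_assoc T.tmult_bracket_left
        T.tmult_bracket_right M.bracket_closed act_closed act_bracket_affine assoc right
        intro: T.bracket_comm M.bracket_comm M.bracket_assoc
          M.bracket_cancel_left M.bracket_cancel_right\<close>)
qed

lemma absorber_ext_truss_iff:
  assumes e: "e \<in> carrier M"
  shows "absorber (ext_truss T M act e) (z, u) \<longleftrightarrow> absorber T z \<and> u = e \<and> carrier M = {e}"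
proof
  assume A: "absorber (ext_truss T M act e) (z, u)"
  then have z: "z \<in> carrier T" and u: "u \<in> carrier M"
    and left: "\<And>t m. t \<in> carrier T \<Longrightarrow> m \<in> carrier M \<Longrightarrow>
      z \<cdot>\<^bsub>T\<^esub> t = z \<and> \<langle>u, act z e, act z m\<rangle>\<^bsub>M\<^esub> = u"
    and right: "\<And>t m. t \<in> carrier T \<Longrightarrow> m \<in> carrier M \<Longrightarrow>
      t \<cdot>\<^bsub>T\<^esub> z = z \<and> \<langle>m, act t e, act t u\<rangle>\<^bsub>M\<^esub> = u"
    by (auto simp: absorber_def)
  \<comment> \<open>To cancel in [u, ze, zu] = u, apply [ze, u, -] to both sides: one side becomes
    ze, the other reassociates to zu.\<close>
  have "act z e = \<langle>act z e, u, \<langle>u, act z e, act z u\<rangle>\<^bsub>M\<^esub>\<rangle>\<^bsub>M\<^esub>"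
    using left[OF z u] z u e by (simp add: act_closed M.bracket_cancel_right)
  also have "\<dots> = \<langle>\<langle>act z e, u, u\<rangle>\<^bsub>M\<^esub>, act z e, act z u\<rangle>\<^bsub>M\<^esub>"
    using z u e by (simp only: M.bracket_assoc act_closed)
  also have "\<dots> = act z u"
    using z u e by (simp add: act_closed M.bracket_cancel_left M.bracket_cancel_right)
  finally have "act z u = act z e" ..
  then have "m = u" if "m \<in> carrier M" for m
    using right[OF z that] that z e by (simp add: act_closed M.bracket_cancel_right)
  moreover have "absorber T z"
    using z left right u by (auto simp: absorber_def)
  ultimately show "absorber T z \<and> u = e \<and> carrier M = {e}"
    using e by blast
next
  assume *: "absorber T z \<and> u = e \<and> carrier M = {e}"
  \<comment> \<open>On a one-point module the action is trivial, so only the condition on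
    \<open>z\<close> remains.\<close>
  then have "act t e = e" if "t \<in> carrier T" for t
    using act_closed[OF that e] by simp
  then show "absorber (ext_truss T M act e) (z, u)"
    using * e by (auto simp: absorber_def M.bracket_cancel_left)
qed

end

theorem lemma4p3:
  fixes T :: "'t truss" and M :: "'m heap" and act :: "'t \<Rightarrow> 'm \<Rightarrow> 'm" and e :: 'm
  assumes "truss T"
    and "truss_module T M act"
    and "e \<in> carrier M"
  shows "ring_type (ext_truss T M act e) \<longleftrightarrow>
    carrier M = {e} \<and>
    (\<exists>R :: 't ring. nonunital_ring R \<and> same_truss T (truss_of_ring R))"
proof -
  interpret truss_module T M act by (rule assms)
  have "ring_type (ext_truss T M act e) \<longleftrightarrow> carrier M = {e} \<and> (\<exists>z. absorber T z)"
    using assms(3) by (auto simp: ring_type_def truss_ext_truss absorber_ext_truss_iff)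
  \<comment> \<open>Forwards, R is the retract at the absorber; backwards, the absorber is the zero
    of R.\<close>
  also have "(\<exists>z. absorber T z) \<longleftrightarrow>
      (\<exists>R :: 't ring. nonunital_ring R \<and> same_truss T (truss_of_ring R))"
    using absorber_of_ring T.nonunital_ring_retract T.same_truss_retract
    by (metis absorber_def)
  finally show ?thesis .
qed

end
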